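(* Let $\phi$ be a solution of the sine-Gordon equation $\phi_{xy}=\sin\phi$. The inverse recursion operator $\mathcal R^{-1}$, defined by the equivalence $\Phi\equiv\mathcal R^{-1}\Psi\Leftrightarrow\Psi\equiv\mathcal R\Phi$, coincides with the operator $\mathcal R'$. That is, for functions $\Phi,\Psi$: $\Phi$ solves the Moutard equation $\Phi_{xy}=\Phi\cos\phi$ and there is a function $Q$ with $$\Psi=\Phi_{xx}+\phi_xQ,\qquad Q_x=\Phi_x\phi_x,\qquad Q_y=\Phi\sin\phi,$$ if and only if $\Psi$ solves the Moutard equation $\Psi_{xy}=\Psi\cos\phi$ and there is a function $Q'$ with $$\Phi=\Psi_{yy}+\phi_yQ',\qquad Q'_y=\Psi_y\phi_y,\qquad Q'_x=\Psi\sin\phi.$$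
   Context: All functions are smooth on an open set $U\subset\mathbb R^2$ with coordinates $x,y$; subscripts denote partial derivatives. The recursion operator $\mathcal R$ (in Guthrie's form) is a multivalued operator (a relation) on solutions of the Moutard equation $\Phi_{xy}=\Phi\cos\phi$: one writes $\Psi\equiv\mathcal R\Phi$ if $\Psi=\Phi_{xx}+\phi_xQ$ for some $Q$ satisfying $Q_x=\Phi_x\phi_x$, $Q_y=\Phi\sin\phi$. The operator $\mathcal R'$ is obtained by exchanging $x$ and $y$: $\mathcal R'\Psi=\Psi_{yy}+\phi_yQ'$, where $Q'_y=\Psi_y\phi_y$, $Q'_x=\Psi\sin\phi$. *)

theory Defs
  imports "HOL-Analysis.Analysis"
begin

definition Dx :: "(real \<times> real \<Rightarrow> real) \<Rightarrow> real \<times> real \<Rightarrow> real"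
  where "Dx f = (\<lambda>(x, y). deriv (\<lambda>t. f (t, y)) x)"

definition Dy :: "(real \<times> real \<Rightarrow> real) \<Rightarrow> real \<times> real \<Rightarrow> real"
  where "Dy f = (\<lambda>(x, y). deriv (\<lambda>t. f (x, t)) y)"

text \<open>
  Functions on an open set \<open>U\<close> are represented by total functions whose values outside \<open>U\<close> are
  irrelevant. \<open>Ck_on n U f\<close> is meant for open \<open>U\<close>; differentiability (in the Frechet sense) is
  demanded at each level, so the total operators \<open>Dx\<close> and \<open>Dy\<close> yield genuine partial
  derivatives on \<open>U\<close>.
\<close>

primrec Ck_on :: "nat \<Rightarrow> (real \<times> real) set \<Rightarrow> (real \<times> real \<Rightarrow> real) \<Rightarrow> bool" where
  "Ck_on 0 U f \<longleftrightarrow> continuous_on U f"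
| "Ck_on (Suc n) U f \<longleftrightarrow>
     (\<forall>p\<in>U. f differentiable (at p)) \<and> Ck_on n U (Dx f) \<and> Ck_on n U (Dy f)"

definition smooth_on :: "(real \<times> real) set \<Rightarrow> (real \<times> real \<Rightarrow> real) \<Rightarrow> bool"
  where "smooth_on U f \<longleftrightarrow> (\<forall>n. Ck_on n U f)"

definition sine_Gordon :: "(real \<times> real) set \<Rightarrow> (real \<times> real \<Rightarrow> real) \<Rightarrow> bool"
  where "sine_Gordon U \<phi> \<longleftrightarrow> smooth_on U \<phi> \<and> (\<forall>p\<in>U. Dy (Dx \<phi>) p = sin (\<phi> p))"

definition Moutard ::
    "(real \<times> real) set \<Rightarrow> (real \<times> real \<Rightarrow> real) \<Rightarrow> (real \<times> real \<Rightarrow> real) \<Rightarrow> bool"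
  where "Moutard U \<phi> \<Phi> \<longleftrightarrow> smooth_on U \<Phi> \<and> (\<forall>p\<in>U. Dy (Dx \<Phi>) p = \<Phi> p * cos (\<phi> p))"

text \<open>
  The recursion operator is multivalued, hence a relation: \<open>recursion U \<phi> \<Phi> \<Psi>\<close> says that \<open>\<Psi>\<close> is
  one of the values of the operator at the solution \<open>\<Phi>\<close> of the Moutard equation. That \<open>\<Psi>\<close> solves
  the Moutard equation as well is not part of the definition.
\<close>

definition recursion ::
    "(real \<times> real) set \<Rightarrow> (real \<times> real \<Rightarrow> real) \<Rightarrow>
     (real \<times> real \<Rightarrow> real) \<Rightarrow> (real \<times> real \<Rightarrow> real) \<Rightarrow> bool"
  where "recursion U \<phi> \<Phi> \<Psi> \<longleftrightarrow>
    Moutard U \<phi> \<Phi> \<and> smooth_on U \<Psi> \<and>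
    (\<exists>Q. smooth_on U Q \<and>
      (\<forall>p\<in>U. \<Psi> p = Dx (Dx \<Phi>) p + Dx \<phi> p * Q p
            \<and> Dx Q p = Dx \<Phi> p * Dx \<phi> p
            \<and> Dy Q p = \<Phi> p * sin (\<phi> p)))"

text \<open>The operator with \<open>x\<close> and \<open>y\<close> exchanged, written with its argument \<open>\<Psi>\<close> first.\<close>

definition recursion' ::
    "(real \<times> real) set \<Rightarrow> (real \<times> real \<Rightarrow> real) \<Rightarrow>
     (real \<times> real \<Rightarrow> real) \<Rightarrow> (real \<times> real \<Rightarrow> real) \<Rightarrow> bool"
  where "recursion' U \<phi> \<Psi> \<Phi> \<longleftrightarrow>
    Moutard U \<phi> \<Psi> \<and> smooth_on U \<Phi> \<and>
    (\<exists>Q'. smooth_on U Q' \<and>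
      (\<forall>p\<in>U. \<Phi> p = Dy (Dy \<Psi>) p + Dy \<phi> p * Q' p
            \<and> Dy Q' p = Dy \<Psi> p * Dy \<phi> p
            \<and> Dx Q' p = \<Psi> p * sin (\<phi> p)))"

definition inverse_recursion ::
    "(real \<times> real) set \<Rightarrow> (real \<times> real \<Rightarrow> real) \<Rightarrow>
     (real \<times> real \<Rightarrow> real) \<Rightarrow> (real \<times> real \<Rightarrow> real) \<Rightarrow> bool"
  where "inverse_recursion U \<phi> \<Psi> \<Phi> \<longleftrightarrow> recursion U \<phi> \<Phi> \<Psi>"

end

theory Submission
  imports Defs
begin

text \<open>
  If \<open>\<Psi> = \<Phi>\<^sub>x\<^sub>x + \<phi>\<^sub>x Q\<close>, then \<open>\<Psi>\<^sub>y = \<Phi>\<^sub>x cos \<phi> + Q sin \<phi>\<close>, and the potential that inverts the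
  operator is \<open>Q' = \<Phi>\<^sub>x sin \<phi> - Q cos \<phi>\<close>: all the required identities follow by differentiating
  these two expressions. The converse is the same statement after exchanging \<open>x\<close> and \<open>y\<close>, because
  mixed partial derivatives commute.
\<close>

section \<open>Partial derivatives\<close>

text \<open>Composing with the line \<open>t \<mapsto> (t, snd p)\<close> reduces Frechet
  differentiability to one variable, where \<open>deriv\<close> is the actual derivative. This gives
  the total operator \<open>Dx\<close> its meaning.\<close>

lemma has_partial_x:
  assumes "f differentiable (at p)"
  shows "((\<lambda>t. f (t, snd p)) has_real_derivative Dx f p) (at (fst p))"
proof -
  have "(\<lambda>t. (t, snd p)) differentiable (at (fst p))"
    unfolding differentiable_def
    by (rule exI) (rule has_derivative_Pair[OF has_derivative_ident has_derivative_const])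
  then have "(f \<circ> (\<lambda>t. (t, snd p))) differentiable (at (fst p))"
    using assms by (intro differentiable_chain_at) auto
  then show ?thesis
    by (simp add: Dx_def o_def case_prod_beta DERIV_deriv_iff_real_differentiable)
qed

lemma has_partial_y:
  assumes "f differentiable (at p)"
  shows "((\<lambda>t. f (fst p, t)) has_real_derivative Dy f p) (at (snd p))"
proof -
  have "(\<lambda>t. (fst p, t)) differentiable (at (snd p))"
    unfolding differentiable_def
    by (rule exI) (rule has_derivative_Pair[OF has_derivative_const has_derivative_ident])
  then have "(f \<circ> (\<lambda>t. (fst p, t))) differentiable (at (snd p))"
    using assms by (intro differentiable_chain_at) auto
  then show ?thesis
    by (simp add: Dy_def o_def case_prod_beta DERIV_deriv_iff_real_differentiable)
qed

lemma Dx_eqI: "((\<lambda>t. f (t, snd p)) has_real_derivative D) (at (fst p)) \<Longrightarrow> Dx f p = D"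
  by (auto simp: Dx_def case_prod_beta intro: DERIV_imp_deriv)

lemma Dy_eqI: "((\<lambda>t. f (fst p, t)) has_real_derivative D) (at (snd p)) \<Longrightarrow> Dy f p = D"
  by (auto simp: Dy_def case_prod_beta intro: DERIV_imp_deriv)

lemma
  assumes "f differentiable (at p)" "g differentiable (at p)"
  shows Dx_add: "Dx (\<lambda>p. f p + g p) p = Dx f p + Dx g p"
    and Dy_add: "Dy (\<lambda>p. f p + g p) p = Dy f p + Dy g p"
    and Dx_diff: "Dx (\<lambda>p. f p - g p) p = Dx f p - Dx g p"
    and Dy_diff: "Dy (\<lambda>p. f p - g p) p = Dy f p - Dy g p"
    and Dx_mult: "Dx (\<lambda>p. f p * g p) p = Dx f p * g p + f p * Dx g p"
    and Dy_mult: "Dy (\<lambda>p. f p * g p) p = Dy f p * g p + f p * Dy g p"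
proof -
  show "Dx (\<lambda>p. f p + g p) p = Dx f p + Dx g p"
    using DERIV_add[OF has_partial_x[OF assms(1)] has_partial_x[OF assms(2)]]
    by (intro Dx_eqI) simp
  show "Dy (\<lambda>p. f p + g p) p = Dy f p + Dy g p"
    using DERIV_add[OF has_partial_y[OF assms(1)] has_partial_y[OF assms(2)]]
    by (intro Dy_eqI) simp
  show "Dx (\<lambda>p. f p - g p) p = Dx f p - Dx g p"
    using DERIV_diff[OF has_partial_x[OF assms(1)] has_partial_x[OF assms(2)]]
    by (intro Dx_eqI) simp
  show "Dy (\<lambda>p. f p - g p) p = Dy f p - Dy g p"
    using DERIV_diff[OF has_partial_y[OF assms(1)] has_partial_y[OF assms(2)]]
    by (intro Dy_eqI) simp
  show "Dx (\<lambda>p. f p * g p) p = Dx f p * g p + f p * Dx g p"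
    using DERIV_mult[OF has_partial_x[OF assms(1)] has_partial_x[OF assms(2)]]
    by (intro Dx_eqI) (simp add: mult.commute)
  show "Dy (\<lambda>p. f p * g p) p = Dy f p * g p + f p * Dy g p"
    using DERIV_mult[OF has_partial_y[OF assms(1)] has_partial_y[OF assms(2)]]
    by (intro Dy_eqI) (simp add: mult.commute)
qed

lemma
  assumes "f differentiable (at p)"
  shows Dx_minus: "Dx (\<lambda>p. - f p) p = - Dx f p"
    and Dy_minus: "Dy (\<lambda>p. - f p) p = - Dy f p"
    and Dx_sin: "Dx (\<lambda>p. sin (f p)) p = cos (f p) * Dx f p"
    and Dy_sin: "Dy (\<lambda>p. sin (f p)) p = cos (f p) * Dy f p"
    and Dx_cos: "Dx (\<lambda>p. cos (f p)) p = - sin (f p) * Dx f p"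
    and Dy_cos: "Dy (\<lambda>p. cos (f p)) p = - sin (f p) * Dy f p"
proof -
  show "Dx (\<lambda>p. - f p) p = - Dx f p"
    using DERIV_minus[OF has_partial_x[OF assms]] by (intro Dx_eqI) simp
  show "Dy (\<lambda>p. - f p) p = - Dy f p"
    using DERIV_minus[OF has_partial_y[OF assms]] by (intro Dy_eqI) simp
  show "Dx (\<lambda>p. sin (f p)) p = cos (f p) * Dx f p"
    using DERIV_fun_sin[OF has_partial_x[OF assms]] by (intro Dx_eqI) simp
  show "Dy (\<lambda>p. sin (f p)) p = cos (f p) * Dy f p"
    using DERIV_fun_sin[OF has_partial_y[OF assms]] by (intro Dy_eqI) simp
  show "Dx (\<lambda>p. cos (f p)) p = - sin (f p) * Dx f p"
    using DERIV_fun_cos[OF has_partial_x[OF assms]] by (intro Dx_eqI) simp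
  show "Dy (\<lambda>p. cos (f p)) p = - sin (f p) * Dy f p"
    using DERIV_fun_cos[OF has_partial_y[OF assms]] by (intro Dy_eqI) simp
qed

text \<open>Openness of \<open>U\<close> makes the horizontal and vertical slices through
  \<open>p\<close> open, so the two functions agree near the point on each line. This is what
  permits differentiating an equation that holds only on \<open>U\<close>.\<close>

lemma
  assumes "open U" "\<And>q. q \<in> U \<Longrightarrow> f q = g q" "p \<in> U"
  shows Dx_cong: "Dx f p = Dx g p" and Dy_cong: "Dy f p = Dy g p"
proof -
  obtain x y where p: "p = (x, y)"
    by (cases p)
  have "open ((\<lambda>t. (t, y)) -` U)" "open ((\<lambda>t. (x, t)) -` U)"
    using assms(1) by (auto intro!: open_vimage continuous_intros)
  then have "\<forall>\<^sub>F t in nhds x. t \<in> (\<lambda>t. (t, y)) -` U" "\<forall>\<^sub>F t in nhds y. t \<in> (\<lambda>t. (x, t)) -` U"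
    using assms(3) unfolding p by (metis eventually_nhds_in_open vimageI)+
  then have "\<forall>\<^sub>F t in nhds x. f (t, y) = g (t, y)" "\<forall>\<^sub>F t in nhds y. f (x, t) = g (x, t)"
    by (auto elim!: eventually_mono intro!: assms(2))
  then show "Dx f p = Dx g p" "Dy f p = Dy g p"
    unfolding Dx_def Dy_def p by (auto intro!: deriv_cong_ev)
qed

section \<open>Smooth functions\<close>

lemma Ck_on_SucD: "Ck_on (Suc n) U f \<Longrightarrow> Ck_on n U f"
proof (induction n arbitrary: f)
  case 0
  then show ?case
    by (simp add: differentiable_imp_continuous_on differentiable_on_def differentiable_at_withinI)
next
  case (Suc n)
  show ?case
    using Suc.prems Suc.IH[of "Dx f"] Suc.IH[of "Dy f"] by simp
qed

text \<open>By \<open>Dx_cong\<close> and \<open>Dy_cong\<close> the partial derivatives again agree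
  on \<open>U\<close>, so the induction passes to them. It serves to replace the derivative of a
  compound function by its formula, which is valid on \<open>U\<close> only.\<close>

lemma Ck_on_cong:
  assumes "open U"
  shows "(\<And>p. p \<in> U \<Longrightarrow> f p = g p) \<Longrightarrow> Ck_on n U f \<Longrightarrow> Ck_on n U g"
proof (induction n arbitrary: f g)
  case 0
  then show ?case
    using continuous_on_cong[of U U f g] by simp
next
  case (Suc n)
  have "g differentiable (at p)" if p: "p \<in> U" for p
  proof -
    have "f differentiable (at p)"
      using Suc.prems p by simp
    then obtain f' where "(f has_derivative f') (at p)"
      by (auto simp: differentiable_def)
    then have "(g has_derivative f') (at p)"
      using assms p Suc.prems(1) by (rule has_derivative_transform_within_open)
    then show ?thesis
      by (auto simp: differentiable_def)
  qed
  moreover have "Ck_on n U (Dx g)"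
  proof (rule Suc.IH)
    show "Dx f p = Dx g p" if "p \<in> U" for p
      using assms Suc.prems(1) that by (rule Dx_cong)
  qed (use Suc.prems in simp)
  moreover have "Ck_on n U (Dy g)"
  proof (rule Suc.IH)
    show "Dy f p = Dy g p" if "p \<in> U" for p
      using assms Suc.prems(1) that by (rule Dy_cong)
  qed (use Suc.prems in simp)
  ultimately show ?case
    by simp
qed

section \<open>Closure of the classes \<open>Ck_on\<close> under arithmetic, sine and cosine\<close>

lemma Ck_on_minus: "open U \<Longrightarrow> Ck_on n U f \<Longrightarrow> Ck_on n U (\<lambda>p. - f p)"
proof (induction n arbitrary: f)
  case (Suc n)
  have "Ck_on n U (Dx (\<lambda>p. - f p))"
    by (rule Ck_on_cong[where f = "\<lambda>p. - Dx f p"]) (use Suc in \<open>auto simp: Dx_minus\<close>)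
  moreover have "Ck_on n U (Dy (\<lambda>p. - f p))"
    by (rule Ck_on_cong[where f = "\<lambda>p. - Dy f p"]) (use Suc in \<open>auto simp: Dy_minus\<close>)
  ultimately show ?case
    using Suc.prems by auto
qed (auto intro: continuous_intros)

lemma Ck_on_add: "open U \<Longrightarrow> Ck_on n U f \<Longrightarrow> Ck_on n U g \<Longrightarrow> Ck_on n U (\<lambda>p. f p + g p)"
proof (induction n arbitrary: f g)
  case (Suc n)
  have "Ck_on n U (Dx (\<lambda>p. f p + g p))"
    by (rule Ck_on_cong[where f = "\<lambda>p. Dx f p + Dx g p"]) (use Suc in \<open>auto simp: Dx_add\<close>)
  moreover have "Ck_on n U (Dy (\<lambda>p. f p + g p))"
    by (rule Ck_on_cong[where f = "\<lambda>p. Dy f p + Dy g p"]) (use Suc in \<open>auto simp: Dy_add\<close>)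
  ultimately show ?case
    using Suc.prems by auto
qed (auto intro: continuous_intros)

lemma Ck_on_mult: "open U \<Longrightarrow> Ck_on n U f \<Longrightarrow> Ck_on n U g \<Longrightarrow> Ck_on n U (\<lambda>p. f p * g p)"
proof (induction n arbitrary: f g)
  case (Suc n)
  \<comment> \<open>The product rule leaves one factor undifferentiated, so \<open>f\<close> and
    \<open>g\<close> themselves are needed at the lower level \<open>n\<close>.\<close>
  have fg: "Ck_on n U f" "Ck_on n U g"
    using Suc.prems Ck_on_SucD by blast+
  have "Ck_on n U (Dx (\<lambda>p. f p * g p))"
    by (rule Ck_on_cong[where f = "\<lambda>p. Dx f p * g p + f p * Dx g p"])
      (use Suc fg in \<open>auto simp: Dx_mult intro!: Ck_on_add\<close>)
  moreover have "Ck_on n U (Dy (\<lambda>p. f p * g p))"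
    by (rule Ck_on_cong[where f = "\<lambda>p. Dy f p * g p + f p * Dy g p"])
      (use Suc fg in \<open>auto simp: Dy_mult intro!: Ck_on_add\<close>)
  ultimately show ?case
    using Suc.prems by auto
qed (auto intro: continuous_intros)

lemma differentiable_sin_cos:
  fixes f :: "'a::real_normed_vector \<Rightarrow> real"
  assumes "f differentiable (at p)"
  shows "(\<lambda>p. sin (f p)) differentiable (at p)" "(\<lambda>p. cos (f p)) differentiable (at p)"
  using assms unfolding differentiable_def
  by (blast intro: has_derivative_sin has_derivative_cos)+

text \<open>The derivative of each of the two functions contains the other, so the induction has to
  treat them together.\<close>

lemma Ck_on_sin_cos:
  "open U \<Longrightarrow> Ck_on n U f \<Longrightarrow> Ck_on n U (\<lambda>p. sin (f p)) \<and> Ck_on n U (\<lambda>p. cos (f p))"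
proof (induction n)
  case (Suc n)
  have sc: "Ck_on n U (\<lambda>p. sin (f p))" "Ck_on n U (\<lambda>p. cos (f p))"
    using Suc Ck_on_SucD by blast+
  have "Ck_on n U (Dx (\<lambda>p. sin (f p)))"
    by (rule Ck_on_cong[where f = "\<lambda>p. cos (f p) * Dx f p"])
      (use Suc.prems sc in \<open>auto simp: Dx_sin intro!: Ck_on_mult\<close>)
  moreover have "Ck_on n U (Dy (\<lambda>p. sin (f p)))"
    by (rule Ck_on_cong[where f = "\<lambda>p. cos (f p) * Dy f p"])
      (use Suc.prems sc in \<open>auto simp: Dy_sin intro!: Ck_on_mult\<close>)
  moreover have "Ck_on n U (Dx (\<lambda>p. cos (f p)))"
    by (rule Ck_on_cong[where f = "\<lambda>p. - (sin (f p) * Dx f p)"])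
      (use Suc.prems sc in \<open>auto simp: Dx_cos intro!: Ck_on_mult Ck_on_minus\<close>)
  moreover have "Ck_on n U (Dy (\<lambda>p. cos (f p)))"
    by (rule Ck_on_cong[where f = "\<lambda>p. - (sin (f p) * Dy f p)"])
      (use Suc.prems sc in \<open>auto simp: Dy_cos intro!: Ck_on_mult Ck_on_minus\<close>)
  ultimately show ?case
    using Suc.prems by (auto intro: differentiable_sin_cos)
qed (auto intro: continuous_intros)

section \<open>Passage from \<open>Ck_on\<close> to smooth functions\<close>

lemma smooth_on_differentiable: "smooth_on U f \<Longrightarrow> p \<in> U \<Longrightarrow> f differentiable (at p)"
  unfolding smooth_on_def by (metis Ck_on.simps(2))

lemma smooth_on_continuous_on: "smooth_on U f \<Longrightarrow> continuous_on U f"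
  unfolding smooth_on_def by (metis Ck_on.simps(1))

lemma smooth_on_Dx: "smooth_on U f \<Longrightarrow> smooth_on U (Dx f)"
  unfolding smooth_on_def by (metis Ck_on.simps(2))

lemma smooth_on_Dy: "smooth_on U f \<Longrightarrow> smooth_on U (Dy f)"
  unfolding smooth_on_def by (metis Ck_on.simps(2))

lemma smooth_on_mult:
  "open U \<Longrightarrow> smooth_on U f \<Longrightarrow> smooth_on U g \<Longrightarrow> smooth_on U (\<lambda>p. f p * g p)"
  by (simp add: smooth_on_def Ck_on_mult)

lemma smooth_on_diff:
  "open U \<Longrightarrow> smooth_on U f \<Longrightarrow> smooth_on U g \<Longrightarrow> smooth_on U (\<lambda>p. f p - g p)"
  using Ck_on_add[OF _ _ Ck_on_minus, of U _ f g] by (simp add: smooth_on_def)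

lemma smooth_on_sin: "open U \<Longrightarrow> smooth_on U f \<Longrightarrow> smooth_on U (\<lambda>p. sin (f p))"
  by (simp add: smooth_on_def Ck_on_sin_cos)

lemma smooth_on_cos: "open U \<Longrightarrow> smooth_on U f \<Longrightarrow> smooth_on U (\<lambda>p. cos (f p))"
  by (simp add: smooth_on_def Ck_on_sin_cos)

section \<open>Exchanging the coordinates\<close>

text \<open>Both sides unfold to the \<open>deriv\<close> of the same one-variable function. As an
  equation between functions it also rewrites below further partial derivatives.\<close>

lemma Dx_swap: "Dx (f \<circ> prod.swap) = Dy f \<circ> prod.swap"
  by (auto simp: Dx_def Dy_def)

lemma Dy_swap: "Dy (f \<circ> prod.swap) = Dx f \<circ> prod.swap"
  by (auto simp: Dx_def Dy_def)

lemma open_swap_vimage: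
  fixes U :: "('a::topological_space \<times> 'b::topological_space) set"
  shows "open U \<Longrightarrow> open (prod.swap -` U)"
  by (rule open_vimage) (auto intro: continuous_on_swap)

lemma differentiable_swap:
  fixes f :: "real \<times> real \<Rightarrow> real"
  assumes "f differentiable (at (prod.swap p))"
  shows "(f \<circ> prod.swap) differentiable (at p)"
proof -
  have "(prod.swap has_derivative (\<lambda>h. (snd h, fst h))) (at p)"
    unfolding prod.swap_def by (auto intro!: derivative_eq_intros)
  then show ?thesis
    using assms by (intro differentiable_chain_at) (auto simp: differentiable_def)
qed

lemma Ck_on_swap: "Ck_on n U f \<Longrightarrow> Ck_on n (prod.swap -` U) (f \<circ> prod.swap)"
proof (induction n arbitrary: f)
  case 0
  then show ?case
    by (auto intro!: continuous_on_compose2[OF _ continuous_on_swap] simp: o_def)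
next
  case (Suc n)
  have "(f \<circ> prod.swap) differentiable (at p)" if "p \<in> prod.swap -` U" for p
    using Suc.prems that by (intro differentiable_swap) simp
  moreover have "Ck_on n (prod.swap -` U) (Dx (f \<circ> prod.swap))"
    unfolding Dx_swap using Suc.prems by (intro Suc.IH) simp
  moreover have "Ck_on n (prod.swap -` U) (Dy (f \<circ> prod.swap))"
    unfolding Dy_swap using Suc.prems by (intro Suc.IH) simp
  ultimately show ?case
    unfolding Ck_on.simps by blast
qed

lemma smooth_on_swap: "smooth_on U f \<Longrightarrow> smooth_on (prod.swap -` U) (f \<circ> prod.swap)"
  by (simp add: smooth_on_def Ck_on_swap)

lemma swap_swap_fun: "(f \<circ> prod.swap) \<circ> prod.swap = f"
  by (simp add: fun_eq_iff)

lemma swap_swap_vimage: "prod.swap -` (prod.swap -` U) = U"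
  by auto

section \<open>Symmetry of mixed partial derivatives\<close>

text \<open>The mean value theorem is applied twice: to \<open>f (x, b + h) - f (x, b)\<close> in
  \<open>x\<close>, then to \<open>Dx f (s, y)\<close> in \<open>y\<close>. The left-hand side is
  symmetric in the coordinates, which allows a comparison of the two mixed derivatives.\<close>

lemma second_difference:
  assumes f: "smooth_on U f" and box: "{a..a + h} \<times> {b..b + h} \<subseteq> U" and h: "h > 0"
  obtains s t where "s \<in> {a..a + h}" "t \<in> {b..b + h}"
    "f (a + h, b + h) - f (a + h, b) - f (a, b + h) + f (a, b) = h * h * Dy (Dx f) (s, t)"
proof -
  have px: "((\<lambda>t. f (t, y)) has_real_derivative Dx f (x, y)) (at x)" if "(x, y) \<in> U" for x y
    using has_partial_x[OF smooth_on_differentiable[OF f that]] by simp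
  have py: "((\<lambda>t. Dx f (x, t)) has_real_derivative Dy (Dx f) (x, y)) (at y)"
    if "(x, y) \<in> U" for x y
    using has_partial_y[OF smooth_on_differentiable[OF smooth_on_Dx[OF f] that]] by simp
  have "\<exists>s. a < s \<and> s < a + h \<and>
      (f (a + h, b + h) - f (a + h, b)) - (f (a, b + h) - f (a, b))
      = (a + h - a) * (Dx f (s, b + h) - Dx f (s, b))"
    using box h by (intro MVT2 DERIV_diff px) auto
  then obtain s where s: "a < s" "s < a + h"
    "f (a + h, b + h) - f (a + h, b) - (f (a, b + h) - f (a, b))
      = h * (Dx f (s, b + h) - Dx f (s, b))"
    by auto
  have "\<exists>t. b < t \<and> t < b + h \<and>
      Dx f (s, b + h) - Dx f (s, b) = (b + h - b) * Dy (Dx f) (s, t)"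
    using box h s by (intro MVT2 py) auto
  then obtain t where t: "b < t" "t < b + h" "Dx f (s, b + h) - Dx f (s, b) = h * Dy (Dx f) (s, t)"
    by auto
  show thesis
    by (rule that[of s t]) (use s t in \<open>simp_all add: algebra_simps\<close>)
qed

text \<open>On a small square at \<open>p\<close> the same second difference is \<open>h * h\<close>
  times either mixed derivative at some point. If the two differed at \<open>p\<close>, continuity
  would keep them apart on a small enough square.\<close>

lemma Dx_Dy_commute:
  assumes "open U" and f: "smooth_on U f" and "p \<in> U"
  shows "Dx (Dy f) p = Dy (Dx f) p"
proof (rule ccontr)
  assume neq: "Dx (Dy f) p \<noteq> Dy (Dx f) p"
  obtain x y where p: "p = (x, y)"
    by (cases p)
  define e where "e = dist (Dx (Dy f) p) (Dy (Dx f) p)"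
  have "e > 0"
    using neq by (simp add: e_def)
  have near: "\<forall>\<^sub>F q in nhds p. dist (g q) (g p) < e / 2" if "smooth_on U g" for g
  proof -
    have "isCont g p"
      using smooth_on_continuous_on[OF that] assms by (simp add: continuous_on_eq_continuous_at)
    then have "(g \<longlongrightarrow> g p) (nhds p)"
      by (simp add: continuous_at tendsto_nhds_iff)
    then show ?thesis
      using \<open>e > 0\<close> by (simp only: tendstoD half_gt_zero)
  qed
  have "\<forall>\<^sub>F q in nhds p. q \<in> U \<and> dist (Dx (Dy f) q) (Dx (Dy f) p) < e / 2
      \<and> dist (Dy (Dx f) q) (Dy (Dx f) p) < e / 2"
    using assms near by (auto intro!: eventually_conj eventually_nhds_in_open smooth_on_Dx smooth_on_Dy)
  then obtain d where d: "d > 0" and d':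
    "\<And>q. dist q p < d \<Longrightarrow> q \<in> U \<and> dist (Dx (Dy f) q) (Dx (Dy f) p) < e / 2
      \<and> dist (Dy (Dx f) q) (Dy (Dx f) p) < e / 2"
    unfolding eventually_nhds_metric by blast
  \<comment> \<open>On the square of side \<open>h\<close> the distance to the corner
    \<open>p\<close> is at most \<open>2 * h\<close>, which is less than \<open>d\<close>.\<close>
  define h where "h = d / 3"
  have h: "h > 0"
    using d by (simp add: h_def)
  have close: "dist (s, t) p < d" if "s \<in> {x..x + h}" "t \<in> {y..y + h}" for s t
  proof -
    have "dist (s, t) p \<le> \<bar>s - x\<bar> + \<bar>t - y\<bar>"
      unfolding p dist_Pair_Pair dist_real_def using sqrt_sum_squares_le_sum_abs by simp
    then show ?thesis
      using that d by (simp add: h_def)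
  qed
  have box: "{x..x + h} \<times> {y..y + h} \<subseteq> U"
    using close d' by auto
  obtain s t where st: "s \<in> {x..x + h}" "t \<in> {y..y + h}"
    "f (x + h, y + h) - f (x + h, y) - f (x, y + h) + f (x, y) = h * h * Dy (Dx f) (s, t)"
    using second_difference[OF f box h] by metis
  \<comment> \<open>For \<open>f \<circ> prod.swap\<close> the second difference is the same number
    with its middle terms exchanged, while \<open>Dy (Dx _)\<close> turns into
    \<open>Dx (Dy f)\<close>.\<close>
  obtain t' s' where st': "t' \<in> {y..y + h}" "s' \<in> {x..x + h}"
    "f (x + h, y + h) - f (x, y + h) - f (x + h, y) + f (x, y) = h * h * Dx (Dy f) (s', t')"
  proof (rule second_difference[OF smooth_on_swap[OF f], of y h x])
    show "{y..y + h} \<times> {x..x + h} \<subseteq> prod.swap -` U"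
      using box by auto
  qed (use h that in \<open>auto simp: Dx_swap Dy_swap\<close>)
  have "h * h * Dy (Dx f) (s, t) = h * h * Dx (Dy f) (s', t')"
    using st(3) st'(3) by linarith
  then have "Dy (Dx f) (s, t) = Dx (Dy f) (s', t')"
    using h by simp
  moreover have "dist (Dy (Dx f) (s, t)) (Dy (Dx f) p) < e / 2"
    "dist (Dx (Dy f) (s', t')) (Dx (Dy f) p) < e / 2"
    using d' close st st' by blast+
  ultimately show False
    using dist_triangle_half_r[of "Dx (Dy f) (s', t')" "Dx (Dy f) p" e "Dy (Dx f) p"]
    by (simp add: e_def)
qed

section \<open>The recursion operators\<close>

text \<open>After the exchange the equation reads \<open>Dx (Dy \<phi>) = sin \<phi>\<close>, so the
  symmetry of mixed derivatives is what makes it invariant.\<close>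

lemma sine_Gordon_swap:
  "open U \<Longrightarrow> sine_Gordon U \<phi> \<Longrightarrow> sine_Gordon (prod.swap -` U) (\<phi> \<circ> prod.swap)"
  by (auto simp: sine_Gordon_def smooth_on_swap Dx_swap Dy_swap Dx_Dy_commute)

lemma Moutard_swap:
  "open U \<Longrightarrow> Moutard U \<phi> \<Phi> \<Longrightarrow> Moutard (prod.swap -` U) (\<phi> \<circ> prod.swap) (\<Phi> \<circ> prod.swap)"
  by (auto simp: Moutard_def smooth_on_swap Dx_swap Dy_swap Dx_Dy_commute)

text \<open>The exchange carries the system for \<open>Q'\<close> into the system for
  \<open>Q\<close>, with \<open>\<Psi>\<close> now as the argument; the potential is the old one
  composed with the exchange.\<close>

lemma recursion_swap:
  assumes "open U" "recursion' U \<phi> \<Psi> \<Phi>"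
  shows "recursion (prod.swap -` U) (\<phi> \<circ> prod.swap) (\<Psi> \<circ> prod.swap) (\<Phi> \<circ> prod.swap)"
proof -
  obtain Q where "smooth_on U Q" "\<forall>p\<in>U. \<Phi> p = Dy (Dy \<Psi>) p + Dy \<phi> p * Q p
      \<and> Dy Q p = Dy \<Psi> p * Dy \<phi> p \<and> Dx Q p = \<Psi> p * sin (\<phi> p)"
    using assms by (auto simp: recursion'_def)
  then show ?thesis
    using assms unfolding recursion_def recursion'_def
    by (auto simp: Moutard_swap smooth_on_swap Dx_swap Dy_swap intro!: exI[of _ "Q \<circ> prod.swap"])
qed

text \<open>The exchange is an involution, so the preceding lemma, applied to the exchanged data,
  leads back to the original ones.\<close>

lemma recursion'_swap:
  assumes "open U" "recursion' (prod.swap -` U) (\<phi> \<circ> prod.swap) (\<Phi> \<circ> prod.swap) (\<Psi> \<circ> prod.swap)"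
  shows "recursion U \<phi> \<Phi> \<Psi>"
  using recursion_swap[OF open_swap_vimage[OF assms(1)] assms(2)]
  by (simp only: swap_swap_fun swap_swap_vimage)

lemma recursion_imp_recursion':
  assumes U: "open U" and "sine_Gordon U \<phi>" and "recursion U \<phi> \<Phi> \<Psi>"
  shows "recursion' U \<phi> \<Psi> \<Phi>"
proof -
  obtain Q where Q: "smooth_on U Q"
    and \<Psi>: "\<And>p. p \<in> U \<Longrightarrow> \<Psi> p = Dx (Dx \<Phi>) p + Dx \<phi> p * Q p"
    and Qx: "\<And>p. p \<in> U \<Longrightarrow> Dx Q p = Dx \<Phi> p * Dx \<phi> p"
    and Qy: "\<And>p. p \<in> U \<Longrightarrow> Dy Q p = \<Phi> p * sin (\<phi> p)"
    and \<Phi>: "smooth_on U \<Phi>" and \<Phi>xy: "\<And>p. p \<in> U \<Longrightarrow> Dy (Dx \<Phi>) p = \<Phi> p * cos (\<phi> p)"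
    and s\<Psi>: "smooth_on U \<Psi>"
    using assms(3) by (auto simp: recursion_def Moutard_def)
  have \<phi>: "smooth_on U \<phi>" and \<phi>xy: "\<And>p. p \<in> U \<Longrightarrow> Dy (Dx \<phi>) p = sin (\<phi> p)"
    using assms(2) by (auto simp: sine_Gordon_def)
  note smooth = Q \<Phi> \<phi> s\<Psi> smooth_on_Dx smooth_on_Dy smooth_on_mult[OF U] smooth_on_diff[OF U]
    smooth_on_sin[OF U] smooth_on_cos[OF U]
  note partials = Dx_add Dy_add Dx_diff Dy_diff Dx_mult Dy_mult Dx_sin Dy_sin Dx_cos Dy_cos
  \<comment> \<open>\<open>R\<close> will be the potential \<open>Q'\<close> and \<open>S\<close>
    will be \<open>Dy \<Psi>\<close>. The pair \<open>(S, R)\<close> arises from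
    \<open>(Dx \<Phi>, Q)\<close> by a reflection matrix with entries \<open>cos \<phi>\<close>,
    \<open>sin \<phi>\<close>, \<open>sin \<phi>\<close>, \<open>- cos \<phi>\<close>.\<close>
  define R where "R = (\<lambda>p. Dx \<Phi> p * sin (\<phi> p) - Q p * cos (\<phi> p))"
  define S where "S = (\<lambda>p. Dx \<Phi> p * cos (\<phi> p) + Q p * sin (\<phi> p))"
  have d: "f differentiable (at p)" if "smooth_on U f" "p \<in> U" for f p
    using that smooth_on_differentiable by blast
  have \<Psi>y: "Dy \<Psi> p = S p" if p: "p \<in> U" for p
  proof -
    \<comment> \<open>Moving the \<open>y\<close>-derivative inside makes the Moutard equation
      applicable; it is then differentiated in \<open>x\<close>.\<close>
    have "Dy (Dx (Dx \<Phi>)) p = Dx (Dy (Dx \<Phi>)) p"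
      using p by (simp add: Dx_Dy_commute[OF U] smooth)
    also have "\<dots> = Dx (\<lambda>q. \<Phi> q * cos (\<phi> q)) p"
      using p by (intro Dx_cong[OF U] \<Phi>xy)
    also have "\<dots> = Dx \<Phi> p * cos (\<phi> p) - \<Phi> p * sin (\<phi> p) * Dx \<phi> p"
      using p by (simp add: partials d smooth)
    finally have *: "Dy (Dx (Dx \<Phi>)) p = Dx \<Phi> p * cos (\<phi> p) - \<Phi> p * sin (\<phi> p) * Dx \<phi> p" .
    have "Dy \<Psi> p = Dy (\<lambda>q. Dx (Dx \<Phi>) q + Dx \<phi> q * Q q) p"
      using p by (intro Dy_cong[OF U] \<Psi>)
    \<comment> \<open>The term \<open>\<Phi> sin \<phi> Dx \<phi>\<close> cancels against
      \<open>Dx \<phi> * Dy Q\<close>, and the sine-Gordon equation turns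
      \<open>Dy (Dx \<phi>) * Q\<close> into \<open>Q sin \<phi>\<close>.\<close>
    then show ?thesis
      using p by (simp add: partials d smooth * \<phi>xy Qy S_def)
  qed
  have "Dy (Dx \<Psi>) p = \<Psi> p * cos (\<phi> p)" if p: "p \<in> U" for p
  proof -
    \<comment> \<open>The other order of differentiation is used because \<open>Dy \<Psi>\<close> is
      known to be \<open>S\<close>. In \<open>Dx S\<close> the terms with
      \<open>Dx \<Phi> * Dx \<phi>\<close> cancel by the equation for \<open>Dx Q\<close>.\<close>
    have "Dy (Dx \<Psi>) p = Dx (Dy \<Psi>) p"
      using p by (simp add: Dx_Dy_commute[OF U] smooth)
    also have "\<dots> = Dx S p"
      using p by (intro Dx_cong[OF U] \<Psi>y)
    also have "\<dots> = \<Psi> p * cos (\<phi> p)"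
      unfolding S_def using p by (simp add: partials d smooth Qx \<Psi> algebra_simps)
    finally show ?thesis .
  qed
  then have "Moutard U \<phi> \<Psi>"
    by (simp add: Moutard_def s\<Psi>)
  moreover have "smooth_on U R"
    unfolding R_def by (intro smooth)
  moreover have "\<Phi> p = Dy (Dy \<Psi>) p + Dy \<phi> p * R p" if p: "p \<in> U" for p
  proof -
    have "Dy (Dy \<Psi>) p = Dy S p"
      using p by (intro Dy_cong[OF U] \<Psi>y)
    \<comment> \<open>One square comes from the Moutard equation, the other from
      \<open>Dy Q\<close>. The Pythagorean rules are withheld until both sides are expanded.\<close>
    also have "\<dots> = \<Phi> p * ((cos (\<phi> p))\<^sup>2 + (sin (\<phi> p))\<^sup>2) - Dy \<phi> p * R p"
      unfolding S_def R_def using p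
      by (simp add: partials d smooth Qy \<Phi>xy algebra_simps power2_eq_square
          del: sin_cos_squared_add sin_cos_squared_add2 sin_cos_squared_add3)
    finally show ?thesis
      by simp
  qed
  moreover have "Dy R p = Dy \<Psi> p * Dy \<phi> p" if p: "p \<in> U" for p
    unfolding R_def using p \<Psi>y[OF p]
    by (simp add: partials d smooth Qy \<Phi>xy S_def algebra_simps)
  moreover have "Dx R p = \<Psi> p * sin (\<phi> p)" if p: "p \<in> U" for p
    unfolding R_def using p
    by (simp add: partials d smooth Qx \<Psi> algebra_simps)
  ultimately show ?thesis
    using \<Phi> by (auto simp: recursion'_def)
qed

theorem proposition4p4:
  fixes U :: "(real \<times> real) set" and \<phi> :: "real \<times> real \<Rightarrow> real"
  assumes "open U" and "sine_Gordon U \<phi>"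
  shows "inverse_recursion U \<phi> = recursion' U \<phi>"
proof (intro ext iffI)
  fix \<Psi> \<Phi>
  show "recursion' U \<phi> \<Psi> \<Phi>" if "inverse_recursion U \<phi> \<Psi> \<Phi>"
    using that assms by (simp add: inverse_recursion_def recursion_imp_recursion')
  \<comment> \<open>Exchanging coordinates turns the hypothesis into an instance of
    \<open>recursion\<close>; the implication already proved is applied on the exchanged domain, and
    the result is exchanged back.\<close>
  show "inverse_recursion U \<phi> \<Psi> \<Phi>" if "recursion' U \<phi> \<Psi> \<Phi>"
    unfolding inverse_recursion_def
  proof (rule recursion'_swap[OF assms(1)], rule recursion_imp_recursion')
    show "recursion (prod.swap -` U) (\<phi> \<circ> prod.swap) (\<Psi> \<circ> prod.swap) (\<Phi> \<circ> prod.swap)"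
      using assms(1) that by (rule recursion_swap)
  qed (use assms in \<open>simp_all add: open_swap_vimage sine_Gordon_swap\<close>)
qed

end
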